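(* Let $M$ be a connected surface in $E^3$ consisting only of elliptic points (Gauss curvature $K>0$ everywhere), with position vector $x$ and unit normal (Gauss map) $n$, and let $\varphi$ be a sufficiently differentiable real function on $M$. Then $$\nabla^{I}(\varphi,x)+\nabla^{II}(\varphi,n)=0\qquad\text{and}\qquad \nabla^{II}(\varphi,x)+\nabla^{III}(\varphi,n)=0 .$$
   Context: $M$ is a connected (sufficiently differentiable) surface in Euclidean 3-space $E^3$ with local coordinates $u^1,u^2$; $/i$ denotes $\partial/\partial u^i$ and repeated indices are summed. The fundamental forms $I,II,III$ have components $g_{ij}=\langle x_{/i},x_{/j}\rangle$, $b_{ij}=\langle x_{/ij},n\rangle$, $e_{ij}=\langle n_{/i},n_{/j}\rangle$, respectively. The first differential parameter of Beltrami with respect to $J=I,II,III$ is $\nabla^{J}(\varphi,\psi):=a^{ij}\varphi_{/i}\psi_{/j}$, where $(a^{ij})$ is the inverse of $(g_{ij})$, $(b_{ij})$, $(e_{ij})$ for $J=I,II,III$ respectively; $\psi$ may be vector-valued, in which case the formula is taken componentwise. *)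

theory Defs
  imports "HOL-Analysis.Analysis"
begin

definition partial :: "2 \<Rightarrow> (real^2 \<Rightarrow> 'b::real_normed_vector) \<Rightarrow> real^2 \<Rightarrow> 'b" where
  "partial i f u = vector_derivative (\<lambda>t. f (u + t *\<^sub>R axis i 1)) (at 0)"

text \<open>Class \<open>C\<^sup>k\<close> on a set \<open>U\<close>, which is open in all uses below.\<close>

fun Ck_on :: "nat \<Rightarrow> (real^2) set \<Rightarrow> (real^2 \<Rightarrow> 'b::real_normed_vector) \<Rightarrow> bool" where
  "Ck_on 0 U f \<longleftrightarrow> continuous_on U f"
| "Ck_on (Suc k) U f \<longleftrightarrow> f differentiable_on U \<and> (\<forall>i. Ck_on k U (partial i f))"

text \<open>Local coordinates are given by local parametrizations: a pair \<open>(U, X)\<close> stands for the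
  chart whose coordinate map is the inverse of \<open>X : U \<rightarrow> X ` U\<close>. Only the values of \<open>X\<close> on \<open>U\<close> matter.\<close>

type_synonym 'a chart = "(real^2) set \<times> (real^2 \<Rightarrow> 'a)"

definition Ck_atlas :: "nat \<Rightarrow> 'a::topological_space set \<Rightarrow> 'a chart set \<Rightarrow> bool" where
  "Ck_atlas k M \<A> \<longleftrightarrow>
     (\<forall>(U, X)\<in>\<A>. open U \<and> openin (top_of_set M) (X ` U) \<and> (\<exists>Y. homeomorphism U (X ` U) X Y)) \<and>
     (\<Union>(U, X)\<in>\<A>. X ` U) = M \<and>
     (\<forall>(U, X)\<in>\<A>. \<forall>(V, Y)\<in>\<A>.
        Ck_on k {u\<in>U. X u \<in> Y ` V} (\<lambda>u. inv_into V Y (X u)))"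

definition Ck_on_surface ::
  "nat \<Rightarrow> 'a chart set \<Rightarrow> ('a \<Rightarrow> 'b::real_normed_vector) \<Rightarrow> bool" where
  "Ck_on_surface k \<A> f \<longleftrightarrow> (\<forall>(U, X)\<in>\<A>. Ck_on k U (f \<circ> X))"

text \<open>A surface of class \<open>C\<^sup>k\<close> in Euclidean 3-space: a 2-manifold \<open>M\<close> with atlas \<open>\<A>\<close>, immersed by
  its position vector \<open>x\<close>. Embedded surfaces are the case where \<open>M\<close> is a subset of \<open>\<real>\<^sup>3\<close> and \<open>x\<close> the
  identity.\<close>

definition surface_in_E3 ::
  "nat \<Rightarrow> 'a::{t2_space,second_countable_topology} set \<Rightarrow> 'a chart set \<Rightarrow> ('a \<Rightarrow> real^3) \<Rightarrow> bool" where
  "surface_in_E3 k M \<A> x \<longleftrightarrow>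
     Ck_atlas k M \<A> \<and> Ck_on_surface k \<A> x \<and>
     (\<forall>(U, X)\<in>\<A>. \<forall>u\<in>U. inj (frechet_derivative (x \<circ> X) (at u)))"

text \<open>Continuity fixes the choice of sign coherently.\<close>

definition gauss_map ::
  "'a::topological_space set \<Rightarrow> 'a chart set \<Rightarrow> ('a \<Rightarrow> real^3) \<Rightarrow> ('a \<Rightarrow> real^3) \<Rightarrow> bool" where
  "gauss_map M \<A> x n \<longleftrightarrow>
     continuous_on M n \<and> (\<forall>p\<in>M. norm (n p) = 1) \<and>
     (\<forall>(U, X)\<in>\<A>. \<forall>u\<in>U. \<forall>i. partial i (x \<circ> X) u \<bullet> n (X u) = 0)"

text \<open>The arguments \<open>x\<close> and \<open>n\<close> below are coordinate expressions, i.e. position vector and normal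
  composed with a local parametrization.\<close>

definition form_I :: "(real^2 \<Rightarrow> real^3) \<Rightarrow> real^2 \<Rightarrow> real^2^2" where
  "form_I x u = (\<chi> i j. partial i x u \<bullet> partial j x u)"

definition form_II :: "(real^2 \<Rightarrow> real^3) \<Rightarrow> (real^2 \<Rightarrow> real^3) \<Rightarrow> real^2 \<Rightarrow> real^2^2" where
  "form_II x n u = (\<chi> i j. partial j (partial i x) u \<bullet> n u)"

definition form_III :: "(real^2 \<Rightarrow> real^3) \<Rightarrow> real^2 \<Rightarrow> real^2^2" where
  "form_III n u = (\<chi> i j. partial i n u \<bullet> partial j n u)"

definition gauss_curvature :: "(real^2 \<Rightarrow> real^3) \<Rightarrow> (real^2 \<Rightarrow> real^3) \<Rightarrow> real^2 \<Rightarrow> real" where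
  "gauss_curvature x n u = det (form_II x n u) / det (form_I x u)"

definition elliptic_surface :: "'a chart set \<Rightarrow> ('a \<Rightarrow> real^3) \<Rightarrow> ('a \<Rightarrow> real^3) \<Rightarrow> bool" where
  "elliptic_surface \<A> x n \<longleftrightarrow>
     (\<forall>(U, X)\<in>\<A>. \<forall>u\<in>U. gauss_curvature (x \<circ> X) (n \<circ> X) u > 0)"

text \<open>First differential parameter of Beltrami with respect to the form with coefficients \<open>a\<close>, in
  local coordinates; for \<open>\<psi>\<close> with values in \<open>\<real>\<^sup>3\<close> the scalar multiplication makes it componentwise.\<close>

definition beltrami ::
  "(real^2 \<Rightarrow> real^2^2) \<Rightarrow> (real^2 \<Rightarrow> real) \<Rightarrow> (real^2 \<Rightarrow> 'b::real_normed_vector) \<Rightarrow> real^2 \<Rightarrow> 'b" where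
  "beltrami a \<phi> \<psi> u =
     (\<Sum>i\<in>UNIV. \<Sum>j\<in>UNIV. (matrix_inv (a u) $ i $ j * partial i \<phi> u) *\<^sub>R partial j \<psi> u)"

end

theory Submission
  imports Defs
begin

text \<open>In coordinates, write \<open>X\<close> and \<open>N\<close> for the \<open>2 \<times> 3\<close> matrices whose rows are the partial
  derivatives of \<open>x\<close> and \<open>n\<close>. The rows of \<open>N\<close> are tangential and \<open>N X\<^sup>T = -II\<close>, so
  \<open>N = -II I\<inverse> X\<close>; this and \<open>III = N N\<^sup>T\<close> give \<open>I\<inverse> X + II\<inverse> N = 0\<close> and \<open>II\<inverse> X + III\<inverse> N = 0\<close>.
  Differentiability of \<open>n\<close> has to be derived: near each point \<open>n\<close> is a constant sign times the
  normalized cross product of the partial derivatives of \<open>x\<close>.\<close>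

section \<open>Calculus of partial derivatives\<close>

lemma partial_eq_derivative:
  assumes "(f has_derivative D) (at u)"
  shows "partial i f u = D (axis i 1)"
proof -
  have "((\<lambda>t. u + t *\<^sub>R axis i 1) has_derivative (\<lambda>t. t *\<^sub>R axis i 1)) (at (0::real))"
    by (auto intro!: derivative_eq_intros)
  moreover have "(f has_derivative D) (at (u + 0 *\<^sub>R axis i 1))"
    using assms by simp
  ultimately have "((\<lambda>t. f (u + t *\<^sub>R axis i 1)) has_derivative (\<lambda>t. D (t *\<^sub>R axis i 1))) (at 0)"
    by (rule has_derivative_compose)
  moreover have "D (t *\<^sub>R axis i 1) = t *\<^sub>R D (axis i 1)" for t
    using assms has_derivative_linear linear_scale by blast
  ultimately have "((\<lambda>t. f (u + t *\<^sub>R axis i 1)) has_vector_derivative D (axis i 1)) (at 0)"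
    by (simp add: has_vector_derivative_def)
  then show ?thesis
    unfolding partial_def by (rule vector_derivative_at)
qed

text \<open>The chain rule along a coordinate line through \<open>v\<close>, in the one-variable
  form that the mean value theorem asks for.\<close>

lemma has_derivative_along_axis:
  fixes f :: "real^2 \<Rightarrow> real"
  assumes "f differentiable (at (v + s *\<^sub>R axis i 1))"
  shows "((\<lambda>s. f (v + s *\<^sub>R axis i 1)) has_derivative (\<lambda>h. h * partial i f (v + s *\<^sub>R axis i 1)))
    (at s)"
proof -
  obtain D where D: "(f has_derivative D) (at (v + s *\<^sub>R axis i 1))"
    using assms unfolding differentiable_def by blast
  have "((\<lambda>t. v + t *\<^sub>R axis i 1) has_derivative (\<lambda>t. t *\<^sub>R axis i 1)) (at s)"
    by (auto intro!: derivative_eq_intros)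
  from has_derivative_compose[OF this D]
  have "((\<lambda>t. f (v + t *\<^sub>R axis i 1)) has_derivative (\<lambda>t. D (t *\<^sub>R axis i 1))) (at s)" .
  moreover have "D (t *\<^sub>R axis i 1) = t * D (axis i 1)" for t
    using D has_derivative_linear linear_scale real_scaleR_def by metis
  ultimately show ?thesis
    by (simp add: partial_eq_derivative[OF D])
qed

lemma partial_inner:
  fixes f g :: "real^2 \<Rightarrow> 'b::real_inner"
  assumes "f differentiable (at u)" "g differentiable (at u)"
  shows "partial i (\<lambda>v. f v \<bullet> g v) u = f u \<bullet> partial i g u + partial i f u \<bullet> g u"
proof -
  obtain F G where F: "(f has_derivative F) (at u)" and G: "(g has_derivative G) (at u)"
    using assms unfolding differentiable_def by blast
  show ?thesis
    by (simp add: partial_eq_derivative[OF F] partial_eq_derivative[OF G]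
        partial_eq_derivative[OF has_derivative_inner[OF F G]])
qed

lemma partial_const [simp]: "partial i (\<lambda>_. c) u = 0"
  by (simp add: partial_eq_derivative[OF has_derivative_const])

lemma partial_inner_left:
  fixes f :: "real^2 \<Rightarrow> 'b::real_inner"
  assumes "f differentiable (at u)"
  shows "partial i (\<lambda>v. f v \<bullet> c) u = partial i f u \<bullet> c"
  using partial_inner[OF assms, of "\<lambda>_. c"] by simp

text \<open>Identities such as \<open>m v \<bullet> m v = 1\<close> hold only on the chart domain;
  locality of the derivative is what allows differentiating them there.\<close>

lemma partial_cong_open:
  assumes "open U" "u \<in> U" and eq: "\<And>v. v \<in> U \<Longrightarrow> f v = g v"
  shows "partial i f u = partial i g u"
proof -
  have "\<forall>\<^sub>F t in nhds 0. u + t *\<^sub>R axis i 1 \<in> U"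
  proof (rule topological_tendstoD[OF _ assms(1)])
    show "((\<lambda>t::real. u + t *\<^sub>R axis i 1) \<longlongrightarrow> u) (nhds 0)"
      by (rule tendsto_eq_intros filterlim_ident | simp)+
  qed (use assms in auto)
  then have "\<forall>\<^sub>F t in nhds 0. f (u + t *\<^sub>R axis i 1) = g (u + t *\<^sub>R axis i 1)"
    by eventually_elim (rule eq)
  then show ?thesis
    unfolding partial_def by (intro vector_derivative_cong_eq) auto
qed

section \<open>Symmetry of second partial derivatives\<close>

text \<open>Young's argument: the mean value theorem in direction \<open>i\<close> turns the second
  difference into a difference of two values of \<open>partial i f\<close>, which the linear
  approximation of \<open>partial i f\<close> at \<open>u\<close> evaluates up to o(t). The quotient
  is symmetric in \<open>i\<close> and \<open>j\<close>, so its limit gives the symmetry of second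
  derivatives.\<close>

lemma second_difference_tendsto_partial:
  fixes f :: "real^2 \<Rightarrow> real"
  assumes "open U" "u \<in> U" "f differentiable_on U" "partial i f differentiable (at u)"
  shows "((\<lambda>t. (f (u + t *\<^sub>R axis i 1 + t *\<^sub>R axis j 1) - f (u + t *\<^sub>R axis i 1)
      - f (u + t *\<^sub>R axis j 1) + f u) / t\<^sup>2) \<longlongrightarrow> partial j (partial i f) u) (at_right 0)"
    (is "(?q \<longlongrightarrow> ?l) _")
proof (rule tendstoI)
  fix e :: real
  assume "e > 0"
  obtain D where D: "(partial i f has_derivative D) (at u)"
    using assms unfolding differentiable_def by blast
  \<comment> \<open>The approximation is used at distances at most \<open>2 * t\<close> and
    \<open>t\<close> from \<open>u\<close>; with the factor \<open>e / 4\<close> the two errors add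
    up to at most 3/4 of \<open>e * t\<close>.\<close>
  obtain d where "d > 0" and d: "\<And>y. norm (y - u) < d \<Longrightarrow>
      norm (partial i f y - partial i f u - D (y - u)) \<le> e / 4 * norm (y - u)"
    using D \<open>e > 0\<close> unfolding has_derivative_at_alt by (metis divide_pos_pos zero_less_numeral)
  obtain r where "r > 0" and r: "ball u r \<subseteq> U"
    using assms open_contains_ball by blast
  have lin: "linear D" using D has_derivative_linear by blast
  have "dist (?q t) ?l < e" if t: "0 < t" "t < min d r / 2" for t
  proof -
    let ?a = "axis i 1 :: real^2" and ?b = "axis j 1 :: real^2"
    \<comment> \<open>The second difference is \<open>h t - h 0\<close>, an increment of a function
      of one variable.\<close>
    define h where "h s = f (u + t *\<^sub>R ?b + s *\<^sub>R ?a) - f (u + s *\<^sub>R ?a)" for s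
    have nrm: "norm (s *\<^sub>R ?a) \<le> t" "norm (t *\<^sub>R ?b + s *\<^sub>R ?a) \<le> 2 * t" if "0 \<le> s" "s \<le> t" for s
    proof -
      show 1: "norm (s *\<^sub>R ?a) \<le> t" using that by simp
      have "norm (t *\<^sub>R ?b) = t" using t by simp
      with 1 norm_triangle_ineq[of "t *\<^sub>R ?b" "s *\<^sub>R ?a"]
      show "norm (t *\<^sub>R ?b + s *\<^sub>R ?a) \<le> 2 * t" by linarith
    qed
    have inU: "u + w \<in> U" if "norm w \<le> 2 * t" for w
      using r that t by (auto simp: dist_norm subset_iff)
    have diff: "f differentiable (at (u + w))" if "norm w \<le> 2 * t" for w
      using inU[OF that] assms differentiable_on_eq_differentiable_at by blast
    have "\<exists>\<xi>\<in>{0<..<t}. h t - h 0 =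
        (\<lambda>k. k * (partial i f (u + t *\<^sub>R ?b + \<xi> *\<^sub>R ?a) - partial i f (u + \<xi> *\<^sub>R ?a))) (t - 0)"
    proof (rule mvt_simple)
      fix s assume s: "0 \<le> s" "s \<le> t"
      have 1: "f differentiable (at (u + t *\<^sub>R ?b + s *\<^sub>R ?a))"
        using diff[OF nrm(2)[OF s]] by (simp add: add.assoc)
      have 2: "f differentiable (at (u + s *\<^sub>R ?a))"
        using nrm(1)[OF s] t by (intro diff) linarith
      have "(h has_derivative (\<lambda>k. k * partial i f (u + t *\<^sub>R ?b + s *\<^sub>R ?a)
          - k * partial i f (u + s *\<^sub>R ?a))) (at s)"
        unfolding h_def
        by (intro has_derivative_diff has_derivative_along_axis 1 2)
      then show "(h has_derivative (\<lambda>k. k * (partial i f (u + t *\<^sub>R ?b + s *\<^sub>R ?a)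
          - partial i f (u + s *\<^sub>R ?a)))) (at s within {0..t})"
        by (simp add: right_diff_distrib has_derivative_at_withinI)
    qed (use t in auto)
    then obtain \<xi> where \<xi>: "0 < \<xi>" "\<xi> < t" and
      h: "h t - h 0 = t * (partial i f (u + t *\<^sub>R ?b + \<xi> *\<^sub>R ?a) - partial i f (u + \<xi> *\<^sub>R ?a))"
      by auto
    define A where "A = partial i f (u + t *\<^sub>R ?b + \<xi> *\<^sub>R ?a) - partial i f u - D (t *\<^sub>R ?b + \<xi> *\<^sub>R ?a)"
    define B where "B = partial i f (u + \<xi> *\<^sub>R ?a) - partial i f u - D (\<xi> *\<^sub>R ?a)"
    have n: "norm (\<xi> *\<^sub>R ?a) \<le> t" "norm (t *\<^sub>R ?b + \<xi> *\<^sub>R ?a) \<le> 2 * t"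
      using nrm[of \<xi>] \<xi> by auto
    have "\<bar>A\<bar> \<le> e / 4 * norm (t *\<^sub>R ?b + \<xi> *\<^sub>R ?a)"
      using d[of "u + t *\<^sub>R ?b + \<xi> *\<^sub>R ?a"] n t by (simp add: A_def add.assoc)
    also have "\<dots> \<le> e / 4 * (2 * t)"
      using n \<open>e > 0\<close> by (intro mult_left_mono) auto
    finally have A: "\<bar>A\<bar> \<le> e / 4 * (2 * t)" .
    have "\<bar>B\<bar> \<le> e / 4 * norm (\<xi> *\<^sub>R ?a)"
      using d[of "u + \<xi> *\<^sub>R ?a"] n t by (simp add: B_def)
    also have "\<dots> \<le> e / 4 * t"
      using n \<open>e > 0\<close> by (intro mult_left_mono) auto
    finally have B: "\<bar>B\<bar> \<le> e / 4 * t" .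
    \<comment> \<open>The unknown intermediate point \<xi> cancels by linearity of
      \<open>D\<close>.\<close>
    have "D (t *\<^sub>R ?b + \<xi> *\<^sub>R ?a) - D (\<xi> *\<^sub>R ?a) = t * ?l"
      by (simp add: linear_add[OF lin] linear_scale[OF lin] partial_eq_derivative[OF D])
    then have "h t - h 0 = t * (A - B + t * ?l)"
      unfolding h A_def B_def by algebra
    moreover have "?q t = (h t - h 0) / t\<^sup>2"
      by (simp add: h_def algebra_simps)
    ultimately have "?q t = t * (A - B + t * ?l) / t\<^sup>2"
      by simp
    then have q: "?q t - ?l = (A - B) / t"
      using t by (simp add: power2_eq_square add_divide_distrib diff_divide_distrib)
    have "\<bar>A - B\<bar> < e * t"
    proof -
      have "e / 4 * (2 * t) + e / 4 * t < e * t"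
        using t \<open>e > 0\<close> by (simp add: field_simps)
      with A B show ?thesis by linarith
    qed
    then show ?thesis
      unfolding dist_real_def q using t by (simp add: pos_divide_less_eq)
  qed
  then show "\<forall>\<^sub>F t in at_right 0. dist (?q t) ?l < e"
    using \<open>d > 0\<close> \<open>r > 0\<close> unfolding eventually_at_right_field
    by (intro exI[of _ "min d r / 2"]) auto
qed

lemma partial_commute_real:
  fixes f :: "real^2 \<Rightarrow> real"
  assumes "open U" "u \<in> U" "f differentiable_on U" "\<And>i. partial i f differentiable (at u)"
  shows "partial j (partial i f) u = partial i (partial j f) u"
proof (rule tendsto_unique)
  show "((\<lambda>t. (f (u + t *\<^sub>R axis i 1 + t *\<^sub>R axis j 1) - f (u + t *\<^sub>R axis i 1)
      - f (u + t *\<^sub>R axis j 1) + f u) / t\<^sup>2) \<longlongrightarrow> partial j (partial i f) u) (at_right 0)"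
    using assms by (rule second_difference_tendsto_partial)
  show "((\<lambda>t. (f (u + t *\<^sub>R axis i 1 + t *\<^sub>R axis j 1) - f (u + t *\<^sub>R axis i 1)
      - f (u + t *\<^sub>R axis j 1) + f u) / t\<^sup>2) \<longlongrightarrow> partial i (partial j f) u) (at_right 0)"
    using second_difference_tendsto_partial[OF assms, of j i]
    by (simp add: algebra_simps)
qed simp

text \<open>Pairing with a constant vector reduces to the real case; with the normal at
  \<open>u\<close> as \<open>c\<close> this is the symmetry of \<open>form_II\<close>.\<close>

lemma partial_commute_inner:
  fixes f :: "real^2 \<Rightarrow> 'b::real_inner"
  assumes "open U" "u \<in> U" "f differentiable_on U" "\<And>i. partial i f differentiable (at u)"
  shows "partial j (partial i f) u \<bullet> c = partial i (partial j f) u \<bullet> c"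
proof -
  have f: "f differentiable (at v)" if "v \<in> U" for v
    using that assms differentiable_on_eq_differentiable_at by blast
  \<comment> \<open>The derivative of \<open>f v \<bullet> c\<close> agrees with
    \<open>partial i f v \<bullet> c\<close> on \<open>U\<close>, so differentiability at
    \<open>u\<close> is transferred from the latter.\<close>
  have "partial i (\<lambda>v. f v \<bullet> c) differentiable (at u)" for i
  proof -
    have "(\<lambda>v. partial i f v \<bullet> c) differentiable (at u)"
      using assms(4) by simp
    then obtain F where "((\<lambda>v. partial i f v \<bullet> c) has_derivative F) (at u)"
      unfolding differentiable_def by blast
    then have "(partial i (\<lambda>v. f v \<bullet> c) has_derivative F) (at u)"
      by (rule has_derivative_transform_within_open[OF _ assms(1,2)]) (simp add: partial_inner_left f)
    then show ?thesis
      unfolding differentiable_def by blast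
  qed
  moreover have "(\<lambda>v. f v \<bullet> c) differentiable_on U"
    using f assms(1) by (simp add: differentiable_on_eq_differentiable_at)
  ultimately have "partial j (partial i (\<lambda>v. f v \<bullet> c)) u = partial i (partial j (\<lambda>v. f v \<bullet> c)) u"
    using assms by (intro partial_commute_real)
  moreover have "partial j (partial i (\<lambda>v. f v \<bullet> c)) u = partial j (partial i f) u \<bullet> c" for i j
  proof -
    have "partial j (partial i (\<lambda>v. f v \<bullet> c)) u = partial j (\<lambda>v. partial i f v \<bullet> c) u"
      by (intro partial_cong_open[OF assms(1,2)] partial_inner_left f)
    also have "\<dots> = partial j (partial i f) u \<bullet> c"
      by (intro partial_inner_left assms)
    finally show ?thesis .
  qed
  ultimately show ?thesis by simp
qed

section \<open>Cross products and the unit normal\<close>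

text \<open>Lagrange's identity; it converts a nonzero determinant of the first form into linear
  independence of the tangent vectors.\<close>

lemma det_form_I: "det (form_I f u) = (norm (cross3 (partial 1 f u) (partial 2 f u)))\<^sup>2"
  unfolding power2_norm_eq_inner dot_cross
  by (simp add: det_2 form_I_def inner_commute power2_eq_square)

text \<open>The triple product expansion gives \<open>cross3 m (cross3 a b) = 0\<close>; expanding
  one more product with the unit vector \<open>m\<close> shows that \<open>cross3 a b\<close> equals
  its projection onto \<open>m\<close>.\<close>

lemma cross3_eq_normal:
  fixes a b m :: "real^3"
  assumes "a \<bullet> m = 0" "b \<bullet> m = 0" "norm m = 1"
  shows "cross3 a b = (m \<bullet> cross3 a b) *\<^sub>R m"
proof -
  have "cross3 m (cross3 m (cross3 a b)) = 0"
    using assms by (simp add: Lagrange inner_commute)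
  moreover have "m \<bullet> m = 1" using assms(3) by (simp add: norm_eq_1)
  ultimately show ?thesis
    by (simp add: Lagrange[of m m])
qed

text \<open>Since \<open>cross3 a b\<close> is a multiple of \<open>m\<close>, both the inner and
  the cross product of \<open>r\<close> with this nonzero vector vanish.\<close>

lemma orthogonal_to_frame_eq_0:
  fixes a b m r :: "real^3"
  assumes "a \<bullet> m = 0" "b \<bullet> m = 0" "norm m = 1" "cross3 a b \<noteq> 0"
    and "r \<bullet> a = 0" "r \<bullet> b = 0" "r \<bullet> m = 0"
  shows "r = 0"
proof -
  have "cross3 r (cross3 a b) = 0"
    using assms by (simp add: Lagrange)
  moreover have "r \<bullet> cross3 a b = 0"
    using cross3_eq_normal[OF assms(1-3)] assms(7) by (metis inner_scaleR_right mult_zero_right)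
  ultimately show ?thesis
    using assms(4) norm_and_cross_eq_0 by blast
qed

text \<open>\<open>gauss_map\<close> supplies a continuous normal only, while the Weingarten
  relation involves its derivatives.\<close>

lemma unit_normal_differentiable:
  assumes U: "open U" "u \<in> U"
    and f: "\<And>i. partial i f differentiable (at u)"
    and nz: "\<And>v. v \<in> U \<Longrightarrow> cross3 (partial 1 f v) (partial 2 f v) \<noteq> 0"
    and m: "continuous_on U m" "\<And>v. v \<in> U \<Longrightarrow> norm (m v) = 1"
    and orth: "\<And>v i. v \<in> U \<Longrightarrow> partial i f v \<bullet> m v = 0"
    and cont: "\<And>i. continuous_on U (partial i f)"
  shows "m differentiable (at u)"
proof -
  define w where "w v = cross3 (partial 1 f v) (partial 2 f v)" for v
  define c where "c v = m v \<bullet> w v" for v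
  have w: "w v = c v *\<^sub>R m v" if "v \<in> U" for v
    unfolding c_def w_def using that m orth by (intro cross3_eq_normal) auto
  have nc: "norm (w v) = \<bar>c v\<bar>" if "v \<in> U" for v
    using w[OF that] m(2)[OF that] by (metis mult.right_neutral norm_scaleR)
  have c0: "c v \<noteq> 0" if "v \<in> U" for v
    using nz[OF that] w[OF that] unfolding w_def by force
  have "continuous_on U c"
    unfolding c_def w_def by (intro continuous_intros continuous_on_cross m cont)
  \<comment> \<open>The signed length \<open>c\<close> is continuous and has no zero, so
    \<open>c v * c u > 0\<close> describes an open neighbourhood of \<open>u\<close> on which
    \<open>c\<close> keeps the sign of \<open>c u\<close>.\<close>
  then have "continuous_on U (\<lambda>v. c v * c u)"
    by (intro continuous_intros)
  then have "open (U \<inter> (\<lambda>v. c v * c u) -` {0<..})"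
    using U continuous_open_preimage open_greaterThan by blast
  moreover have "u \<in> U \<inter> (\<lambda>v. c v * c u) -` {0<..}"
    using U c0 by (simp add: zero_less_mult_iff) (metis linorder_neqE_linordered_idom)
  moreover have "(sgn (c u) / norm (w v)) *\<^sub>R w v = m v"
    if "v \<in> U \<inter> (\<lambda>v. c v * c u) -` {0<..}" for v
  proof -
    have "c v * c u > 0" "v \<in> U" using that by auto
    then show ?thesis
      using w[of v] nc[of v] by (auto simp: sgn_if zero_less_mult_iff)
  qed
  moreover have "(\<lambda>v. (sgn (c u) / norm (w v)) *\<^sub>R w v) differentiable (at u)"
  proof -
    have "w differentiable (at u)"
    proof -
      obtain F where F: "\<And>i. (partial i f has_derivative F i) (at u)"
        using f unfolding differentiable_def by metis
      have "bounded_bilinear cross3"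
        using bilinear_cross by (simp add: bilinear_conv_bounded_bilinear)
      from bounded_bilinear.FDERIV[OF this F F]
      show ?thesis unfolding w_def differentiable_def by blast
    qed
    moreover have "w u \<noteq> 0" using nz U unfolding w_def by blast
    ultimately show ?thesis
      by (intro differentiable_scaleR differentiable_divide differentiable_compose[of norm w]
          differentiable_norm_at differentiable_const) auto
  qed
  ultimately show ?thesis
    unfolding differentiable_def using has_derivative_transform_within_open by blast
qed

section \<open>Matrix form of the relations\<close>

text \<open>The gradient of \<phi> splits off as a left factor, so both relations reduce to matrix
  identities free of \<phi>.\<close>

lemma beltrami_eq_vector_matrix:
  "beltrami a \<phi> \<psi> u = (\<chi> i. partial i \<phi> u) v* (matrix_inv (a u) ** (\<chi> j. partial j \<psi> u))"
  for \<psi> :: "real^2 \<Rightarrow> real^3"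
  by (simp add: beltrami_def vec_eq_iff vector_matrix_mult_def matrix_matrix_mult_def sum_2
      algebra_simps)

lemma matrix_inv_eqI:
  fixes A B :: "real^'n^'n"
  assumes "A ** B = mat 1"
  shows "matrix_inv A = B"
proof -
  have BA: "B ** A = mat 1" using assms matrix_left_right_inverse by blast
  have "A ** matrix_inv A = mat 1 \<and> matrix_inv A ** A = mat 1"
    unfolding matrix_inv_def using assms BA by (rule_tac someI) blast
  then show ?thesis
    by (metis BA matrix_mul_assoc matrix_mul_lid matrix_mul_rid)
qed

lemma matrix_inv_mult_self:
  fixes A :: "real^'n^'n"
  assumes "det A \<noteq> 0"
  shows "matrix_inv A ** A = mat 1" "A ** matrix_inv A = mat 1"
proof -
  obtain B where "A ** B = mat 1"
    using assms invertible_det_nz[of A] unfolding invertible_def by blast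
  then show "matrix_inv A ** A = mat 1" "A ** matrix_inv A = mat 1"
    using matrix_inv_eqI matrix_left_right_inverse by metis+
qed

lemma matrix_add_rdistrib: "(A + B) ** C = A ** C + B ** C"
  for A B :: "real^'n^'m" and C :: "real^'k^'n"
  by (simp add: matrix_matrix_mult_def vec_eq_iff sum.distrib distrib_right)

lemma matrix_uminus_mult: "(- A) ** B = - (A ** B)" "A ** (- B) = - (A ** B)"
  for A :: "real^'n^'m" and B :: "real^'k^'n"
  by (simp_all add: matrix_matrix_mult_def vec_eq_iff sum_negf)

text \<open>Linear algebra at one point, with \<open>G\<close> and \<open>B\<close> as first and
  second form. The Weingarten equations \<open>N = - (B ** matrix_inv G ** X)\<close>, multiplied by
  \<open>matrix_inv B\<close>, give the first identity. For the second, the third form is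
  \<open>B ** matrix_inv G ** B\<close>, with inverse
  \<open>matrix_inv B ** G ** matrix_inv B\<close>.\<close>

lemma weingarten_inverse_relations:
  fixes X N :: "real^3^2" and m :: "real^3" and B :: "real^2^2"
  assumes X: "X *v m = 0" and N: "N *v m = 0" and m: "norm m = 1"
    and B: "N ** transpose X = - B" "transpose B = B"
    and det: "det (X ** transpose X) \<noteq> 0" "det B \<noteq> 0"
  shows "matrix_inv (X ** transpose X) ** X + matrix_inv B ** N = 0"
    and "matrix_inv B ** X + matrix_inv (N ** transpose N) ** N = 0"
proof -
  define G where "G = X ** transpose X"
  note Gi = matrix_inv_mult_self[OF det(1), folded G_def]
  note Bi = matrix_inv_mult_self[OF det(2)]
  \<comment> \<open>The defect in the Weingarten equations: its rows are orthogonal to both tangent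
    vectors and to \<open>m\<close>, hence zero.\<close>
  define R where "R = N + B ** matrix_inv G ** X"
  have RX: "R ** transpose X = 0"
  proof -
    have "R ** transpose X = - B + B ** (matrix_inv G ** G)"
      unfolding R_def G_def by (simp add: matrix_add_rdistrib B matrix_mul_assoc)
    then show ?thesis by (simp add: Gi)
  qed
  have Rm: "R *v m = 0"
    unfolding R_def
    by (simp add: matrix_vector_mult_add_rdistrib N X flip: matrix_vector_mul_assoc)
  have "R $ i = 0" for i
  proof (rule orthogonal_to_frame_eq_0)
    show "X $ 1 \<bullet> m = 0" "X $ 2 \<bullet> m = 0"
      using X by (simp_all add: vec_eq_iff matrix_vector_mul_component)
    show "norm m = 1" by (rule m)
    have "det (X ** transpose X) = (norm (cross3 (X $ 1) (X $ 2)))\<^sup>2"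
      unfolding power2_norm_eq_inner dot_cross
      by (simp add: det_2 matrix_matrix_mult_def transpose_def
          inner_vec_def power2_eq_square mult.commute)
    then show "cross3 (X $ 1) (X $ 2) \<noteq> 0" using det by auto
    have "(R ** transpose X) $ i $ k = R $ i \<bullet> X $ k" for k
      by (simp add: matrix_matrix_mult_def transpose_def inner_vec_def)
    then show "R $ i \<bullet> X $ 1 = 0" "R $ i \<bullet> X $ 2 = 0"
      using RX by (metis zero_index)+
    show "R $ i \<bullet> m = 0"
      using Rm by (metis matrix_vector_mul_component zero_index)
  qed
  then have "R = 0" by (simp add: vec_eq_iff)
  then have NX: "N = - (B ** matrix_inv G ** X)"
    unfolding R_def by (simp add: add_eq_0_iff2)
  have "matrix_inv B ** N = - (matrix_inv B ** B ** matrix_inv G ** X)"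
    by (simp add: NX matrix_uminus_mult matrix_mul_assoc)
  then show "matrix_inv (X ** transpose X) ** X + matrix_inv B ** N = 0"
    by (simp add: Bi flip: G_def)
  \<comment> \<open>By symmetry of \<open>B\<close> this product is again \<open>- B\<close>, so
    replacing the left factor of \<open>N ** transpose N\<close> by the Weingarten formula yields
    the third form.\<close>
  have "X ** transpose N = transpose (N ** transpose X)"
    by (simp add: matrix_transpose_mul)
  also have "\<dots> = - transpose B"
    unfolding B(1) by (simp add: transpose_def vec_eq_iff)
  finally have "X ** transpose N = - B"
    unfolding B(2) .
  then have E: "N ** transpose N = B ** matrix_inv G ** B"
    by (subst NX) (simp add: matrix_uminus_mult flip: matrix_mul_assoc)
  \<comment> \<open>Bracketed so that the inverse pairs cancel from the inside outwards.\<close>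
  have "B ** matrix_inv G ** B ** (matrix_inv B ** G ** matrix_inv B)
      = B ** (matrix_inv G ** ((B ** matrix_inv B) ** G)) ** matrix_inv B"
    by (simp add: matrix_mul_assoc)
  then have "matrix_inv (N ** transpose N) = matrix_inv B ** G ** matrix_inv B"
    unfolding E by (intro matrix_inv_eqI) (simp add: Bi Gi)
  then have "matrix_inv (N ** transpose N) ** N
      = - (matrix_inv B ** (G ** ((matrix_inv B ** B) ** matrix_inv G)) ** X)"
    by (simp add: NX matrix_uminus_mult matrix_mul_assoc)
  then show "matrix_inv B ** X + matrix_inv (N ** transpose N) ** N = 0"
    by (simp add: Bi Gi)
qed

section \<open>The relations in a chart and on the surface\<close>

lemma beltrami_relations:
  fixes f m :: "real^2 \<Rightarrow> real^3" and \<phi> :: "real^2 \<Rightarrow> real"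
  assumes U: "open U" "u \<in> U"
    and f: "f differentiable_on U" "\<And>i. partial i f differentiable_on U"
    and m: "continuous_on U m" "\<And>v. v \<in> U \<Longrightarrow> norm (m v) = 1"
    and orth: "\<And>v i. v \<in> U \<Longrightarrow> partial i f v \<bullet> m v = 0"
    and K: "\<And>v. v \<in> U \<Longrightarrow> gauss_curvature f m v > 0"
  shows "beltrami (form_I f) \<phi> f u + beltrami (form_II f m) \<phi> m u = 0"
    and "beltrami (form_II f m) \<phi> f u + beltrami (form_III m) \<phi> m u = 0"
proof -
  \<comment> \<open>Division by zero yields 0, so a positive quotient forces both determinants to be
    nonzero.\<close>
  have det: "det (form_I f v) \<noteq> 0" "det (form_II f m v) \<noteq> 0" if "v \<in> U" for v
    using K[OF that] unfolding gauss_curvature_def by auto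
  have fd: "\<And>i. partial i f differentiable (at u)"
    using f U differentiable_on_eq_differentiable_at by blast
  have md: "m differentiable (at u)"
  proof (rule unit_normal_differentiable[OF U fd _ m orth])
    show "cross3 (partial 1 f v) (partial 2 f v) \<noteq> 0" if "v \<in> U" for v
      using det(1)[OF that] unfolding det_form_I by auto
    show "continuous_on U (partial i f)" for i
      using f differentiable_imp_continuous_on by blast
  qed
  define X :: "real^3^2" where "X = (\<chi> i. partial i f u)"
  define N :: "real^3^2" where "N = (\<chi> i. partial i m u)"
  \<comment> \<open>Differentiating the constant squared norm of \<open>m\<close> shows that the
    rows of \<open>N\<close> are tangential.\<close>
  have mm: "m u \<bullet> partial i m u = 0" for i
  proof -
    have "partial i (\<lambda>v. m v \<bullet> m v) u = partial i (\<lambda>v. 1) u"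
      using m by (intro partial_cong_open[OF U]) (simp add: norm_eq_1)
    then show ?thesis
      using partial_inner[OF md md, of i] by (simp add: inner_commute)
  qed
  \<comment> \<open>Differentiating the orthogonality of \<open>partial i f\<close> and
    \<open>m\<close> in direction \<open>j\<close> trades the second derivative of \<open>f\<close>
    for a first derivative of \<open>m\<close>.\<close>
  have fm: "partial i f u \<bullet> partial j m u = - form_II f m u $ i $ j" for i j
  proof -
    have "partial j (\<lambda>v. partial i f v \<bullet> m v) u = partial j (\<lambda>v. 0) u"
      using orth by (intro partial_cong_open[OF U])
    then show ?thesis
      using partial_inner[OF fd md, of j i] by (simp add: form_II_def)
  qed
  have sym: "transpose (form_II f m u) = form_II f m u"
    using partial_commute_inner[OF U f(1) fd]
    by (simp add: form_II_def transpose_def vec_eq_iff)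
  have I: "form_I f u = X ** transpose X" and III: "form_III m u = N ** transpose N"
    by (simp_all add: form_I_def form_III_def X_def N_def matrix_matrix_mult_def transpose_def
        vec_eq_iff inner_vec_def)
  \<comment> \<open>The entries come out with indices interchanged, which is where the symmetry of
    the second form enters.\<close>
  have II: "N ** transpose X = - form_II f m u"
  proof -
    have "(N ** transpose X) $ i $ j = partial j f u \<bullet> partial i m u" for i j
      by (simp add: X_def N_def matrix_matrix_mult_def transpose_def inner_vec_def mult.commute)
    then have "N ** transpose X = - transpose (form_II f m u)"
      by (simp add: vec_eq_iff fm transpose_def)
    then show ?thesis by (simp only: sym)
  qed
  have "X *v m u = 0" "N *v m u = 0"
    using orth U mm
    by (simp_all add: vec_eq_iff X_def N_def matrix_vector_mul_component inner_commute)
  note rel = weingarten_inverse_relations[OF this m(2)[OF U(2)] II sym det(1)[OF U(2), unfolded I]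
      det(2)[OF U(2)], folded I III]
  show "beltrami (form_I f) \<phi> f u + beltrami (form_II f m) \<phi> m u = 0"
    "beltrami (form_II f m) \<phi> f u + beltrami (form_III m) \<phi> m u = 0"
    unfolding beltrami_eq_vector_matrix X_def[symmetric] N_def[symmetric]
      vector_matrix_mult_add_rdistrib[symmetric]
    by (simp_all add: rel)
qed

theorem mainTheorem8:
  fixes M :: "'a::{t2_space,second_countable_topology} set"
    and \<A> :: "'a chart set"
    and x n :: "'a \<Rightarrow> real^3"
    and \<phi> :: "'a \<Rightarrow> real"
  assumes "surface_in_E3 2 M \<A> x"
    and "connected M"
    and "gauss_map M \<A> x n"
    and "elliptic_surface \<A> x n"
    and "Ck_on_surface 1 \<A> \<phi>"
  shows "\<forall>(U, X)\<in>\<A>. \<forall>u\<in>U.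
      beltrami (form_I (x \<circ> X)) (\<phi> \<circ> X) (x \<circ> X) u
        + beltrami (form_II (x \<circ> X) (n \<circ> X)) (\<phi> \<circ> X) (n \<circ> X) u = 0 \<and>
      beltrami (form_II (x \<circ> X) (n \<circ> X)) (\<phi> \<circ> X) (x \<circ> X) u
        + beltrami (form_III (n \<circ> X)) (\<phi> \<circ> X) (n \<circ> X) u = 0"
proof clarify
  fix U X u
  assume c: "(U, X) \<in> \<A>" and u: "u \<in> U"
  \<comment> \<open>The claim is local: each chart supplies the hypotheses of
    \<open>beltrami_relations\<close> on its open domain.\<close>
  have atlas: "Ck_atlas 2 M \<A>" and x: "Ck_on 2 U (x \<circ> X)"
    using assms(1) c unfolding surface_in_E3_def Ck_on_surface_def by auto
  then have U: "open U" and XM: "X ` U \<subseteq> M" and X: "continuous_on U X"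
    using c unfolding Ck_atlas_def homeomorphism_def by auto
  have d: "(x \<circ> X) differentiable_on U" "\<And>i. partial i (x \<circ> X) differentiable_on U"
    using x by (auto simp: numeral_2_eq_2)
  have n: "continuous_on U (n \<circ> X)"
    using assms(3) X XM unfolding gauss_map_def
    by (blast intro: continuous_on_compose continuous_on_subset)
  have n1: "norm ((n \<circ> X) v) = 1" if "v \<in> U" for v
    using assms(3) XM that unfolding gauss_map_def by auto
  have orth: "partial i (x \<circ> X) v \<bullet> (n \<circ> X) v = 0" if "v \<in> U" for v i
    using assms(3) c that unfolding gauss_map_def by auto
  have K: "gauss_curvature (x \<circ> X) (n \<circ> X) v > 0" if "v \<in> U" for v
    using assms(4) c that unfolding elliptic_surface_def by auto
  show "beltrami (form_I (x \<circ> X)) (\<phi> \<circ> X) (x \<circ> X) u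
        + beltrami (form_II (x \<circ> X) (n \<circ> X)) (\<phi> \<circ> X) (n \<circ> X) u = 0 \<and>
      beltrami (form_II (x \<circ> X) (n \<circ> X)) (\<phi> \<circ> X) (x \<circ> X) u
        + beltrami (form_III (n \<circ> X)) (\<phi> \<circ> X) (n \<circ> X) u = 0"
    using beltrami_relations[OF U u d n n1 orth K] by blast
qed

end
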